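(* Let $X$ be a finite-dimensional Euclidean space, let $F\subset X$ be a nonempty closed bounded convex set with $0\in\operatorname{int}F$, let $\Omega_1,\dots,\Omega_n$ be nonempty closed convex subsets of $X$, and let $S\neq\emptyset$ be the set of optimal solutions of the problem $$\text{minimize } T(x):=\sum_{i=1}^n T^F_{\Omega_i}(x),\quad x\in X.$$ Given a sequence $\{\alpha_k\}_{k\in\mathbb N}$ of positive numbers and a starting point $x_1\in X$, consider the algorithm $$x_{k+1}=x_k-\alpha_k\sum_{i=1}^n v_{ik},\quad k=1,2,\dots,$$ with an arbitrary choice of vectors $$v_{ik}\in-\partial\rho_F(\omega_{ik}-x_k)\cap N(\omega_{ik};\Omega_i)\ \text{ for some }\ \omega_{ik}\in\Pi^F_{\Omega_i}(x_k)\quad\text{if }x_k\notin\Omega_i,$$ and $v_{ik}=0$ otherwise. Assume that $$\sum_{k=1}^\infty\alpha_k=\infty\quad\text{and}\quad\ell^2:=\sum_{k=1}^\infty\alpha_k^2<\infty.$$ Then the sequence $\{x_k\}$ converges to an optimal solution of the problem, and the value sequence $V_k:=\min\{T(x_j)\mid j=1,\dots,k\}$ converges to the optimal value $\widehat V$ of the problem. Furthermore, for every $k$, $$V_k-\widehat V\le\frac{d(x_1;S)^2+L^2\ell^2}{2\sum_{i=1}^k\alpha_i},$$ where $0\le L<\infty$ is a Lipschitz constant of $T(\cdot)$ on $X$.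
   Context: For a nonempty closed set $\Omega\subset X$, the minimal time function is $T^F_\Omega(x):=\inf\{t\ge 0 \mid \Omega\cap(x+tF)\ne\emptyset\}$, and the generalized projection is $\Pi^F_\Omega(x):=(x+T^F_\Omega(x)F)\cap\Omega$. The Minkowski gauge is $\rho_F(x):=\inf\{t\ge 0\mid x\in tF\}$, and $\partial\rho_F(u)=\{x^*\mid \langle x^*,x-u\rangle\le\rho_F(x)-\rho_F(u)\ \forall x\in X\}$ is its convex subdifferential ($X$ is identified with its dual). For a convex set $\Omega$ and $\omega\in\Omega$, $N(\omega;\Omega)=\{x^*\mid\langle x^*,x-\omega\rangle\le0\ \forall x\in\Omega\}$. $d(x;S)=\inf\{\|x-s\|\mid s\in S\}$ is the Euclidean distance. The optimal value is $\widehat V=\inf_{x\in X}T(x)$. *)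

theory Defs
  imports "HOL-Analysis.Analysis"
begin

text \<open>The infimum is taken in \<^typ>\<open>real\<close>, so the value is only meaningful when
  the set of admissible times is nonempty. This is automatic if \<open>\<Omega>\<close> is nonempty
  and \<open>0 \<in> interior F\<close>. The same remark applies to the gauge below.\<close>

definition minimal_time :: "'a::real_vector set \<Rightarrow> 'a set \<Rightarrow> 'a \<Rightarrow> real" where
  "minimal_time F \<Omega> x = Inf {t. 0 \<le> t \<and> \<Omega> \<inter> (\<lambda>f. x + t *\<^sub>R f) ` F \<noteq> {}}"

definition gen_projection :: "'a::real_vector set \<Rightarrow> 'a set \<Rightarrow> 'a \<Rightarrow> 'a set" where
  "gen_projection F \<Omega> x = (\<lambda>f. x + minimal_time F \<Omega> x *\<^sub>R f) ` F \<inter> \<Omega>"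

definition minkowski_gauge :: "'a::real_vector set \<Rightarrow> 'a \<Rightarrow> real" where
  "minkowski_gauge F x = Inf {t. 0 \<le> t \<and> x \<in> (\<lambda>f. t *\<^sub>R f) ` F}"

definition subdifferential :: "('a::real_inner \<Rightarrow> real) \<Rightarrow> 'a \<Rightarrow> 'a set" where
  "subdifferential g u = {x'. \<forall>x. inner x' (x - u) \<le> g x - g u}"

definition normal_cone :: "'a::real_inner \<Rightarrow> 'a set \<Rightarrow> 'a set" where
  "normal_cone \<omega> \<Omega> = {x'. \<forall>x\<in>\<Omega>. inner x' (x - \<omega>) \<le> 0}"

definition total_time :: "'a::real_vector set \<Rightarrow> nat \<Rightarrow> (nat \<Rightarrow> 'a set) \<Rightarrow> 'a \<Rightarrow> real" where
  "total_time F n \<Omega> x = (\<Sum>i=1..n. minimal_time F (\<Omega> i) x)"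

definition optimal_solutions :: "('a \<Rightarrow> real) \<Rightarrow> 'a set" where
  "optimal_solutions g = {x. \<forall>y. g x \<le> g y}"

end

theory Submission
  imports Defs
begin

text \<open>The algorithm is a subgradient method in disguise, and the proof has two independent halves.

  The first half is that every admissible choice of \<open>v\<close> is a subgradient of the minimal time
  function at the current point (\<open>subgradient_minimal_time\<close>). The time needed to reach \<open>\<Omega>\<close> from \<open>y\<close>
  is the infimum of \<open>\<rho> (w - y)\<close> over \<open>w \<in> \<Omega>\<close>, where \<open>\<rho>\<close> is the gauge of \<open>F\<close>, and at \<open>x\<close> this infimum
  is attained at the projection \<open>\<omega>\<close>. Moving from \<open>x\<close> to \<open>y\<close> changes the time in two ways: through
  the argument of \<open>\<rho>\<close>, which the subgradient inequality of \<open>\<rho>\<close> at \<open>\<omega> - x\<close> controls, and through the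
  choice of another target point \<open>w\<close>, which the normal cone condition at \<open>\<omega>\<close> shows cannot help to
  first order. Subgradients add up, so each iteration steps against a subgradient of the total
  time.

  The second half is the classical analysis of subgradient descent with square summable steps for
  a Lipschitz function. A subgradient of an \<open>L\<close>-Lipschitz
  function has norm at most \<open>L\<close>, so expanding a square shows that one step changes the squared
  distance to a minimizer \<open>s\<close> by at most
  \<open>- 2 * \<beta> * (T z - T s) + L\<^sup>2 * \<beta>\<^sup>2\<close> (\<open>distance_step\<close>).
  Summing this gives the estimate for the best value found so far; divergence of the sum of the
  steps then forces values arbitrarily close to the optimum arbitrarily late in the iteration. The
  same inequality says that the distance to every minimizer decreases up to a summable error and
  hence converges. The iterates are therefore bounded, some subsequence along which the values
  tend to the optimum converges to a minimizer, and since the distance of the whole sequence to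
  that minimizer has a limit, this limit is zero.\<close>

section \<open>Minimal time functions and their subgradients\<close>

text \<open>Every point is reached by a sufficiently large multiple of \<open>F\<close>, with a linear bound on the
  multiple. The existence of such a multiple makes the infima in gauge and minimal time range over
  nonempty sets; the linear bound becomes the Lipschitz constant of the minimal time.\<close>

lemma absorbing_radius:
  fixes F :: "'a::real_normed_vector set"
  assumes "0 \<in> interior F"
  obtains r where "r > 0" "\<And>u. u \<in> (\<lambda>f. (norm u / r) *\<^sub>R f) ` F"
proof -
  obtain r where r: "r > 0" "cball 0 r \<subseteq> F"
    using assms mem_interior_cball by blast
  have "u \<in> (\<lambda>f. (norm u / r) *\<^sub>R f) ` F" for u :: 'a
  proof (cases "u = 0")
    case True
    with r show ?thesis by (auto intro!: image_eqI[of _ _ 0])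
  next
    case False
    then have "(r / norm u) *\<^sub>R u \<in> F" "u = (norm u / r) *\<^sub>R ((r / norm u) *\<^sub>R u)"
      using r by auto
    then show ?thesis by blast
  qed
  with r show thesis using that by blast
qed

lemma gauge_times_nonempty:
  fixes F :: "'a::real_normed_vector set"
  assumes "0 \<in> interior F"
  shows "{t. 0 \<le> t \<and> u \<in> (\<lambda>f. t *\<^sub>R f) ` F} \<noteq> {}"
proof -
  obtain r where "r > 0" "\<And>u. u \<in> (\<lambda>f. (norm u / r) *\<^sub>R f) ` F"
    using absorbing_radius[OF assms] by metis
  then have "norm u / r \<in> {t. 0 \<le> t \<and> u \<in> (\<lambda>f. t *\<^sub>R f) ` F}"
    by simp
  then show ?thesis by blast
qed

lemma minkowski_gauge_le:
  "0 \<le> t \<Longrightarrow> u \<in> (\<lambda>f. t *\<^sub>R f) ` F \<Longrightarrow> minkowski_gauge F u \<le> t"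
  unfolding minkowski_gauge_def by (rule cInf_lower) (auto intro!: bdd_belowI[of _ 0])

lemma minimal_time_le:
  "0 \<le> t \<Longrightarrow> f \<in> F \<Longrightarrow> x + t *\<^sub>R f \<in> \<Omega> \<Longrightarrow> minimal_time F \<Omega> x \<le> t"
  unfolding minimal_time_def by (rule cInf_lower) (auto intro!: bdd_belowI[of _ 0])

lemma minimal_time_greatest:
  fixes F :: "'a::real_normed_vector set"
  assumes "0 \<in> interior F" "\<Omega> \<noteq> {}"
    and bound: "\<And>t f. 0 \<le> t \<Longrightarrow> f \<in> F \<Longrightarrow> x + t *\<^sub>R f \<in> \<Omega> \<Longrightarrow> c \<le> t"
  shows "c \<le> minimal_time F \<Omega> x"
  unfolding minimal_time_def
proof (rule cInf_greatest)
  obtain w where w: "w \<in> \<Omega>" using assms by blast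
  obtain t f where "0 \<le> t" "f \<in> F" "w - x = t *\<^sub>R f"
    using gauge_times_nonempty[OF assms(1), of "w - x"] by auto
  then have "w = x + t *\<^sub>R f" by (simp add: algebra_simps)
  with w \<open>0 \<le> t\<close> \<open>f \<in> F\<close>
  show "{t. 0 \<le> t \<and> \<Omega> \<inter> (\<lambda>f. x + t *\<^sub>R f) ` F \<noteq> {}} \<noteq> {}" by blast
qed (use bound in blast)

lemma minimal_time_nonneg:
  fixes F :: "'a::real_normed_vector set"
  assumes "0 \<in> interior F" "\<Omega> \<noteq> {}"
  shows "0 \<le> minimal_time F \<Omega> x"
  by (rule minimal_time_greatest[OF assms])

lemma minimal_time_le_gauge:
  fixes F :: "'a::real_normed_vector set"
  assumes "0 \<in> interior F" "w \<in> \<Omega>"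
  shows "minimal_time F \<Omega> x \<le> minkowski_gauge F (w - x)"
  unfolding minkowski_gauge_def
proof (rule cInf_greatest[OF gauge_times_nonempty[OF assms(1)]])
  fix t assume "t \<in> {t. 0 \<le> t \<and> w - x \<in> (\<lambda>f. t *\<^sub>R f) ` F}"
  then obtain f where "0 \<le> t" "f \<in> F" "w - x = t *\<^sub>R f" by blast
  moreover from this have "x + t *\<^sub>R f = w" by (simp add: algebra_simps)
  ultimately show "minimal_time F \<Omega> x \<le> t"
    using assms(2) by (intro minimal_time_le) auto
qed

lemma gauge_at_gen_projection:
  fixes F :: "'a::real_normed_vector set"
  assumes "0 \<in> interior F" "\<omega> \<in> gen_projection F \<Omega> x"
  shows "minkowski_gauge F (\<omega> - x) = minimal_time F \<Omega> x"
proof (rule antisym)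
  have "\<omega> \<in> \<Omega>" and mem: "\<omega> - x \<in> (\<lambda>f. minimal_time F \<Omega> x *\<^sub>R f) ` F"
    using assms(2) by (auto simp: gen_projection_def)
  then show "minimal_time F \<Omega> x \<le> minkowski_gauge F (\<omega> - x)"
    using minimal_time_le_gauge[OF assms(1)] by blast
  show "minkowski_gauge F (\<omega> - x) \<le> minimal_time F \<Omega> x"
    using \<open>\<omega> \<in> \<Omega>\<close> by (intro minkowski_gauge_le minimal_time_nonneg assms(1) mem) auto
qed

text \<open>For \<open>w = y + t *\<^sub>R f\<close> in \<open>\<Omega>\<close>, the subgradient inequality for the gauge, applied to the increment
  \<open>(w - y) - (\<omega> - x)\<close>, splits into a part depending on \<open>y - x\<close> and a part depending on \<open>w - \<omega>\<close>; the
  latter has a favourable sign because \<open>v\<close> is normal to \<open>\<Omega>\<close> at \<open>\<omega>\<close>.\<close>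

lemma subgradient_minimal_time:
  fixes F :: "'a::real_inner set"
  assumes "0 \<in> interior F" and \<omega>: "\<omega> \<in> gen_projection F \<Omega> x"
    and sub: "- v \<in> subdifferential (minkowski_gauge F) (\<omega> - x)"
    and normal: "v \<in> normal_cone \<omega> \<Omega>"
  shows "v \<in> subdifferential (minimal_time F \<Omega>) x"
  unfolding subdifferential_def
proof (intro CollectI allI)
  fix y
  have "minimal_time F \<Omega> x + inner v (y - x) \<le> minimal_time F \<Omega> y"
  proof (rule minimal_time_greatest[OF assms(1)])
    show "\<Omega> \<noteq> {}" using \<omega> by (auto simp: gen_projection_def)
  next
    fix t f assume t: "0 \<le> t" "f \<in> F" "y + t *\<^sub>R f \<in> \<Omega>"
    define w where "w = y + t *\<^sub>R f"
    have "inner (- v) ((w - y) - (\<omega> - x))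
        \<le> minkowski_gauge F (w - y) - minkowski_gauge F (\<omega> - x)"
      using sub by (auto simp: subdifferential_def)
    moreover have "minkowski_gauge F (w - y) \<le> t"
      using t by (intro minkowski_gauge_le) (auto simp: w_def)
    moreover have "inner v (w - \<omega>) \<le> 0"
      using normal t by (auto simp: normal_cone_def w_def)
    ultimately show "minimal_time F \<Omega> x + inner v (y - x) \<le> t"
      by (simp add: gauge_at_gen_projection[OF assms(1) \<omega>] inner_diff_right)
  qed
  then show "inner v (y - x) \<le> minimal_time F \<Omega> y - minimal_time F \<Omega> x" by simp
qed

text \<open>The minimal time vanishes on the target and is nonnegative everywhere, so target points are
  minimizers.\<close>

lemma zero_subgradient_minimal_time:
  fixes F :: "'a::real_inner set"
  assumes "0 \<in> interior F" "x \<in> \<Omega>"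
  shows "0 \<in> subdifferential (minimal_time F \<Omega>) x"
proof -
  have "minimal_time F \<Omega> x \<le> 0"
    using assms interior_subset by (intro minimal_time_le[of 0 0]) auto
  moreover have "0 \<le> minimal_time F \<Omega> y" for y
    using assms by (intro minimal_time_nonneg) auto
  ultimately show ?thesis
    unfolding subdifferential_def by (fastforce intro: order_trans)
qed

text \<open>To reach \<open>\<Omega>\<close> from \<open>x\<close> one may first travel to \<open>y\<close>, which takes time proportional to the
  distance, and continue from there; convexity of \<open>F\<close> turns the two legs into a single
  displacement.\<close>

lemma minimal_time_lipschitz:
  fixes F :: "'a::real_normed_vector set"
  assumes "0 \<in> interior F" "convex F" "\<Omega> \<noteq> {}"
  obtains L where "L-lipschitz_on UNIV (minimal_time F \<Omega>)"
proof -
  obtain r where r: "r > 0" "\<And>u. u \<in> (\<lambda>f. (norm u / r) *\<^sub>R f) ` F"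
    using absorbing_radius[OF assms(1)] by metis
  have le: "minimal_time F \<Omega> x \<le> minimal_time F \<Omega> y + dist x y / r" for x y
  proof -
    have "minimal_time F \<Omega> x - dist x y / r \<le> minimal_time F \<Omega> y"
    proof (rule minimal_time_greatest[OF assms(1,3)])
      fix t f assume t: "0 \<le> t" "f \<in> F" "y + t *\<^sub>R f \<in> \<Omega>"
      define s where "s = norm (y - x) / r"
      have "0 \<le> s" using r by (simp add: s_def)
      obtain g where g: "g \<in> F" "y - x = s *\<^sub>R g" using r(2)[of "y - x"] by (auto simp: s_def)
      have "s *\<^sub>R g + t *\<^sub>R f \<in> (\<lambda>h. (s + t) *\<^sub>R h) ` F"
      proof (cases "s + t = 0")
        case True
        with \<open>0 \<le> s\<close> \<open>0 \<le> t\<close> have "s = 0" "t = 0" by linarith+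
        with g show ?thesis by auto
      next
        case False
        with \<open>0 \<le> s\<close> \<open>0 \<le> t\<close> have pos: "s + t > 0" by linarith
        have "(s / (s + t)) *\<^sub>R g + (t / (s + t)) *\<^sub>R f \<in> F"
          using \<open>0 \<le> s\<close> t g pos
          by (intro convexD[OF assms(2)]) (auto simp: add_divide_distrib[symmetric])
        then show ?thesis
          using pos by (intro image_eqI) (auto simp: scaleR_add_right)
      qed
      then obtain h where h: "h \<in> F" "s *\<^sub>R g + t *\<^sub>R f = (s + t) *\<^sub>R h" by blast
      have "x + (s + t) *\<^sub>R h = y + t *\<^sub>R f"
        using g(2) h(2) by (metis add.assoc add.commute diff_add_cancel)
      then have "minimal_time F \<Omega> x \<le> s + t"
        using h t \<open>0 \<le> s\<close> by (intro minimal_time_le[of _ h]) auto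
      then show "minimal_time F \<Omega> x - dist x y / r \<le> t"
        by (simp add: s_def dist_norm norm_minus_commute)
    qed
    then show ?thesis by simp
  qed
  have "(1 / r)-lipschitz_on UNIV (minimal_time F \<Omega>)"
  proof (rule lipschitz_onI)
    fix x y :: 'a
    show "dist (minimal_time F \<Omega> x) (minimal_time F \<Omega> y) \<le> 1 / r * dist x y"
      using le[of x y] le[of y x] by (auto simp: dist_real_def dist_commute abs_le_iff)
  qed (use r in auto)
  then show thesis by (rule that)
qed

lemma sum_lipschitz:
  fixes f :: "'i \<Rightarrow> 'a::metric_space \<Rightarrow> 'b::real_normed_vector"
  assumes "finite I" "\<And>i. i \<in> I \<Longrightarrow> \<exists>L. L-lipschitz_on X (f i)"
  shows "\<exists>L. L-lipschitz_on X (\<lambda>x. \<Sum>i\<in>I. f i x)"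
  using assms
proof (induction I rule: finite_induct)
  case empty
  show ?case by (auto intro!: exI[of _ 0] lipschitz_onI)
next
  case (insert i I)
  then obtain L M where "L-lipschitz_on X (f i)" "M-lipschitz_on X (\<lambda>x. \<Sum>i\<in>I. f i x)"
    by (metis insert_iff)
  then have "(L + M)-lipschitz_on X (\<lambda>x. f i x + (\<Sum>i\<in>I. f i x))"
    by (rule lipschitz_on_add)
  with insert(1,2) show ?case by auto
qed

lemma subdifferential_sum:
  assumes "\<And>i. i \<in> I \<Longrightarrow> g i \<in> subdifferential (f i) u"
  shows "(\<Sum>i\<in>I. g i) \<in> subdifferential (\<lambda>x. \<Sum>i\<in>I. f i x) u"
  using assms
  by (auto simp: subdifferential_def inner_sum_left sum_subtractf[symmetric] intro!: sum_mono)

section \<open>Subgradient descent for Lipschitz functions\<close>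

text \<open>Testing the subgradient inequality in the direction of the subgradient itself.\<close>

lemma norm_subgradient_le:
  fixes T :: "'a::real_inner \<Rightarrow> real"
  assumes "L-lipschitz_on UNIV T" "g \<in> subdifferential T u"
  shows "norm g \<le> L"
proof (cases "g = 0")
  case True
  then show ?thesis using lipschitz_on_nonneg[OF assms(1)] by simp
next
  case False
  have "inner g ((u + g) - u) \<le> T (u + g) - T u"
    using assms(2) unfolding subdifferential_def by blast
  also have "\<dots> \<le> L * norm g"
    using lipschitz_onD[OF assms(1), of "u + g" u] by (simp add: dist_norm)
  finally have "norm g * norm g \<le> L * norm g"
    by (simp add: norm_eq_square power2_norm_eq_inner[symmetric] power2_eq_square)
  with False show ?thesis by simp
qed

text \<open>Subtracting the accumulated errors turns the sequence into a decreasing one.\<close>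

lemma almost_decreasing_convergent:
  fixes a b :: "nat \<Rightarrow> real"
  assumes nonneg: "\<And>k. 0 \<le> a k" "\<And>k. 0 \<le> b k"
    and step: "\<And>k. a (Suc k) \<le> a k + b k" and "summable b"
  shows "convergent a"
proof -
  define c where "c k = a k - (\<Sum>i<k. b i)" for k
  have "decseq c"
    using step by (auto simp: decseq_Suc_iff c_def algebra_simps)
  moreover have "- suminf b \<le> c k" for k
    using sum_le_suminf[OF \<open>summable b\<close>, of "{..<k}"] nonneg(1)[of k] nonneg(2)
    by (simp add: c_def)
  ultimately obtain l where "c \<longlonglongrightarrow> l" by (metis decseq_convergent)
  then have "(\<lambda>k. c k + (\<Sum>i<k. b i)) \<longlonglongrightarrow> l + suminf b"
    by (intro tendsto_add summable_LIMSEQ \<open>summable b\<close>)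
  then show ?thesis by (auto simp: c_def convergent_def)
qed

locale subgradient_descent =
  fixes T :: "'a::real_inner \<Rightarrow> real" and z g :: "nat \<Rightarrow> 'a" and \<beta> :: "nat \<Rightarrow> real" and L :: real
  assumes lipschitz: "L-lipschitz_on UNIV T"
    and subgradient: "g k \<in> subdifferential T (z k)"
    and step: "z (Suc k) = z k - \<beta> k *\<^sub>R g k"
    and step_pos: "\<beta> k > 0"
    and summable_squares: "summable (\<lambda>k. (\<beta> k)\<^sup>2)"
begin

text \<open>The cross term of the expanded square is bounded by the subgradient inequality between
  \<open>z k\<close> and \<open>s\<close>, the quadratic term by the norm bound on subgradients.\<close>

lemma distance_step:
  "(norm (z (Suc k) - s))\<^sup>2 \<le> (norm (z k - s))\<^sup>2 - 2 * \<beta> k * (T (z k) - T s) + L\<^sup>2 * (\<beta> k)\<^sup>2"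
proof -
  have "inner (g k) (s - z k) \<le> T s - T (z k)"
    using subgradient[of k] unfolding subdifferential_def by blast
  then have "T (z k) - T s \<le> inner (z k - s) (g k)"
    by (simp add: inner_diff_right inner_commute[of _ "g k"])
  then have *: "\<beta> k * (T (z k) - T s) \<le> \<beta> k * inner (z k - s) (g k)"
    using step_pos[of k] by simp
  have "(norm (g k))\<^sup>2 \<le> L\<^sup>2"
    using norm_subgradient_le[OF lipschitz subgradient] by (simp add: power_mono)
  then have **: "(\<beta> k)\<^sup>2 * (norm (g k))\<^sup>2 \<le> (\<beta> k)\<^sup>2 * L\<^sup>2"
    by (simp add: mult_left_mono)
  have eq: "z (Suc k) - s = (z k - s) - \<beta> k *\<^sub>R g k" by (simp add: step)
  have "(norm (z (Suc k) - s))\<^sup>2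
      = (norm (z k - s))\<^sup>2 - 2 * (\<beta> k * inner (z k - s) (g k)) + (\<beta> k)\<^sup>2 * (norm (g k))\<^sup>2"
    unfolding eq power2_norm_eq_inner
    by (simp add: inner_diff_left inner_diff_right inner_commute power2_eq_square algebra_simps)
  with * ** show ?thesis by (simp add: algebra_simps)
qed

lemma weighted_excess_bound:
  "2 * (\<Sum>i<k. \<beta> i * (T (z i) - T s)) \<le> (norm (z 0 - s))\<^sup>2 + L\<^sup>2 * (\<Sum>i. (\<beta> i)\<^sup>2)"
proof -
  have "(norm (z k - s))\<^sup>2 + 2 * (\<Sum>i<k. \<beta> i * (T (z i) - T s))
      \<le> (norm (z 0 - s))\<^sup>2 + L\<^sup>2 * (\<Sum>i<k. (\<beta> i)\<^sup>2)"
  proof (induction k)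
    case (Suc k)
    then show ?case using distance_step[of k s] by (simp add: algebra_simps)
  qed simp
  moreover have "L\<^sup>2 * (\<Sum>i<k. (\<beta> i)\<^sup>2) \<le> L\<^sup>2 * (\<Sum>i. (\<beta> i)\<^sup>2)"
    by (intro mult_left_mono sum_le_suminf summable_squares) auto
  moreover have "0 \<le> (norm (z k - s))\<^sup>2" by simp
  ultimately show ?thesis by linarith
qed

lemma lower_value_excess_bound:
  assumes "k > 0" and w: "\<And>i. i < k \<Longrightarrow> w \<le> T (z i)"
  shows "w - T s \<le> ((norm (z 0 - s))\<^sup>2 + L\<^sup>2 * (\<Sum>i. (\<beta> i)\<^sup>2)) / (2 * (\<Sum>i<k. \<beta> i))"
proof -
  have pos: "(\<Sum>i<k. \<beta> i) > 0"
    using assms(1) step_pos by (intro sum_pos) auto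
  have "(w - T s) * (\<Sum>i<k. \<beta> i) = (\<Sum>i<k. \<beta> i * (w - T s))"
    by (simp add: sum_distrib_left mult.commute)
  also have "\<dots> \<le> (\<Sum>i<k. \<beta> i * (T (z i) - T s))"
    using w step_pos by (intro sum_mono mult_left_mono) (auto simp: less_imp_le)
  finally have "(w - T s) * (2 * (\<Sum>i<k. \<beta> i)) \<le> 2 * (\<Sum>i<k. \<beta> i * (T (z i) - T s))"
    by simp
  also note weighted_excess_bound
  finally show ?thesis using pos by (simp add: pos_le_divide_eq)
qed

lemma norm_diff_minimizer_convergent:
  assumes s: "\<And>y. T s \<le> T y"
  shows "convergent (\<lambda>k. norm (z k - s))"
proof -
  have "convergent (\<lambda>k. (norm (z k - s))\<^sup>2)"
  proof (rule almost_decreasing_convergent)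
    show "summable (\<lambda>k. L\<^sup>2 * (\<beta> k)\<^sup>2)" by (intro summable_mult summable_squares)
    fix k
    have "0 \<le> \<beta> k * (T (z k) - T s)" using step_pos[of k] s by (simp add: less_imp_le)
    then show "(norm (z (Suc k) - s))\<^sup>2 \<le> (norm (z k - s))\<^sup>2 + L\<^sup>2 * (\<beta> k)\<^sup>2"
      using distance_step[of k s] by simp
  qed auto
  then obtain c where "(\<lambda>k. (norm (z k - s))\<^sup>2) \<longlonglongrightarrow> c" by (auto simp: convergent_def)
  then have "(\<lambda>k. sqrt ((norm (z k - s))\<^sup>2)) \<longlonglongrightarrow> sqrt c" by (rule tendsto_real_sqrt)
  then show ?thesis by (auto simp: convergent_def)
qed

text \<open>If the excess stayed above \<open>e\<close> from some index on, the weighted excesses would dominate a tail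
  of the divergent series of steps and could not have bounded partial sums.\<close>

lemma excess_frequently_small:
  assumes s: "\<And>y. T s \<le> T y" and "e > 0"
    and diverges: "filterlim (\<lambda>k. \<Sum>i<k. \<beta> i) at_top sequentially"
  shows "\<exists>k\<ge>N. T (z k) < T s + e"
proof (rule ccontr)
  assume "\<not> ?thesis"
  then have large: "e \<le> T (z k) - T s" if "k \<ge> N" for k
    using that by (force simp: not_less)
  define C where "C = (norm (z 0 - s))\<^sup>2 + L\<^sup>2 * (\<Sum>i. (\<beta> i)\<^sup>2)"
  have "(\<Sum>i<k. \<beta> i) \<le> (\<Sum>i<N. \<beta> i) + C / (2 * e)" for k
  proof -
    have "e * \<beta> i \<le> \<beta> i * (T (z i) - T s) + (if i < N then e * \<beta> i else 0)" for i
      using large[of i] step_pos[of i] s[of "z i"] by (auto simp: mult.commute)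
    then have "(\<Sum>i<k. e * \<beta> i)
        \<le> (\<Sum>i<k. \<beta> i * (T (z i) - T s)) + (\<Sum>i<k. if i < N then e * \<beta> i else 0)"
      unfolding sum.distrib[symmetric] by (intro sum_mono)
    moreover have "(\<Sum>i<k. if i < N then e * \<beta> i else 0) \<le> (\<Sum>i<N. e * \<beta> i)"
      unfolding sum.inter_filter[symmetric, OF finite_lessThan]
      using step_pos \<open>e > 0\<close> by (intro sum_mono2) (auto simp: less_imp_le)
    moreover have "2 * (\<Sum>i<k. \<beta> i * (T (z i) - T s)) \<le> C"
      using weighted_excess_bound by (simp add: C_def)
    ultimately have "2 * (e * (\<Sum>i<k. \<beta> i)) \<le> 2 * (e * (\<Sum>i<N. \<beta> i)) + C"
      unfolding sum_distrib_left[symmetric] by linarith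
    with \<open>e > 0\<close> show ?thesis by (simp add: field_simps)
  qed
  moreover obtain k where "(\<Sum>i<k. \<beta> i) > (\<Sum>i<N. \<beta> i) + C / (2 * e)"
    using diverges unfolding filterlim_at_top_dense eventually_sequentially by blast
  ultimately show False by (simp add: not_less[symmetric])
qed

end

text \<open>Compactness supplies a cluster point that is a minimizer; the convergence of the distances to
  every minimizer then makes it the limit of the whole sequence.\<close>

theorem subgradient_descent_converges:
  fixes T :: "'a::euclidean_space \<Rightarrow> real"
  assumes "subgradient_descent T z g \<beta> L"
    and s: "\<And>y. T s \<le> T y"
    and diverges: "filterlim (\<lambda>k. \<Sum>i<k. \<beta> i) at_top sequentially"
  shows "\<exists>u. (\<forall>y. T u \<le> T y) \<and> z \<longlonglongrightarrow> u"
proof -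
  interpret subgradient_descent T z g \<beta> L by fact
  have "\<forall>j. \<exists>k\<ge>j. T (z k) < T s + inverse (Suc j)"
    using excess_frequently_small[OF s _ diverges] by simp
  then obtain \<kappa> where \<kappa>: "\<And>j. \<kappa> j \<ge> j" "\<And>j. T (z (\<kappa> j)) < T s + inverse (Suc j)"
    by metis
  have "bounded (range z)"
  proof -
    obtain B where "\<And>k. norm (norm (z k - s)) \<le> B"
      using convergent_imp_Bseq[OF norm_diff_minimizer_convergent[OF s]] by (metis BseqE)
    then have "range z \<subseteq> cball s B" by (auto simp: dist_norm norm_minus_commute)
    then show ?thesis using bounded_cball bounded_subset by blast
  qed
  then have "bounded (range (z \<circ> \<kappa>))" by (rule bounded_subset) auto
  then obtain u r where r: "strict_mono r" "((z \<circ> \<kappa>) \<circ> r) \<longlonglongrightarrow> u"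
    using bounded_imp_convergent_subsequence by blast
  have "(\<lambda>j. T (z (\<kappa> j))) \<longlonglongrightarrow> T s"
  proof (rule tendsto_sandwich[OF _ _ tendsto_const LIMSEQ_inverse_real_of_nat_add])
    show "\<forall>\<^sub>F j in sequentially. T s \<le> T (z (\<kappa> j))"
      using s by simp
    show "\<forall>\<^sub>F j in sequentially. T (z (\<kappa> j)) \<le> T s + inverse (real (Suc j))"
      using \<kappa>(2) by (intro always_eventually allI less_imp_le)
  qed
  then have "(\<lambda>j. T (z (\<kappa> (r j)))) \<longlonglongrightarrow> T s"
    using LIMSEQ_subseq_LIMSEQ[OF _ r(1)] by (fastforce simp: o_def)
  moreover have "(\<lambda>j. T (z (\<kappa> (r j)))) \<longlonglongrightarrow> T u"
    using continuous_on_tendsto_compose[OF lipschitz_on_continuous_on[OF lipschitz] r(2)]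
    by (simp add: o_def)
  ultimately have "T u = T s" using LIMSEQ_unique by blast
  then have u: "\<And>y. T u \<le> T y" using s by simp
  obtain c where c: "(\<lambda>k. norm (z k - u)) \<longlonglongrightarrow> c"
    using norm_diff_minimizer_convergent[OF u] by (auto simp: convergent_def)
  have "filterlim (\<lambda>j. \<kappa> (r j)) at_top sequentially"
  proof (rule filterlim_at_top_mono[OF filterlim_ident])
    show "eventually (\<lambda>j. j \<le> \<kappa> (r j)) sequentially"
      using \<kappa>(1) strict_mono_imp_increasing[OF r(1)]
      by (auto intro!: always_eventually intro: order_trans)
  qed
  with c have "(\<lambda>j. norm (z (\<kappa> (r j)) - u)) \<longlonglongrightarrow> c" by (rule filterlim_compose)
  moreover have "(\<lambda>j. norm (z (\<kappa> (r j)) - u)) \<longlonglongrightarrow> 0"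
    using r(2) by (auto simp: o_def tendsto_norm_zero_iff LIM_zero_iff)
  ultimately have "c = 0" using LIMSEQ_unique by blast
  with c have "z \<longlonglongrightarrow> u" by (simp add: tendsto_norm_zero_iff LIM_zero_iff)
  with u show ?thesis by blast
qed

section \<open>Convergence of the algorithm\<close>

theorem theorem5p1:
  fixes F :: "'a::euclidean_space set"
    and n :: nat
    and \<Omega> :: "nat \<Rightarrow> 'a set"
    and T :: "'a \<Rightarrow> real"
    and S :: "'a set"
    and \<alpha> :: "nat \<Rightarrow> real"
    and x :: "nat \<Rightarrow> 'a"
    and v :: "nat \<Rightarrow> nat \<Rightarrow> 'a"
    and V :: "nat \<Rightarrow> real"
    and V_opt l :: real
  assumes "F \<noteq> {}" "closed F" "bounded F" "convex F" "0 \<in> interior F"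
    and "n \<ge> 1"
    and "\<And>i. i \<in> {1..n} \<Longrightarrow> \<Omega> i \<noteq> {} \<and> closed (\<Omega> i) \<and> convex (\<Omega> i)"
    and "T = total_time F n \<Omega>"
    and "S = optimal_solutions T" "S \<noteq> {}"
    and "V_opt = (INF y. T y)"
    and "\<And>k. k \<ge> 1 \<Longrightarrow> \<alpha> k > 0"
    and "\<And>k. k \<ge> 1 \<Longrightarrow> x (Suc k) = x k - \<alpha> k *\<^sub>R (\<Sum>i=1..n. v i k)"
    and "\<And>k i. k \<ge> 1 \<Longrightarrow> i \<in> {1..n} \<Longrightarrow> x k \<notin> \<Omega> i \<Longrightarrow>
           \<exists>\<omega>\<in>gen_projection F (\<Omega> i) (x k).
             v i k \<in> uminus ` subdifferential (minkowski_gauge F) (\<omega> - x k)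
                       \<inter> normal_cone \<omega> (\<Omega> i)"
    and "\<And>k i. k \<ge> 1 \<Longrightarrow> i \<in> {1..n} \<Longrightarrow> x k \<in> \<Omega> i \<Longrightarrow> v i k = 0"
    and "filterlim (\<lambda>N. \<Sum>k=1..N. \<alpha> k) at_top sequentially"
    and "(\<lambda>k. (\<alpha> (Suc k))\<^sup>2) sums l\<^sup>2"
    and "\<And>k. k \<ge> 1 \<Longrightarrow> V k = Min ((\<lambda>j. T (x j)) ` {1..k})"
  shows "(\<exists>s\<in>S. x \<longlonglongrightarrow> s)
    \<and> V \<longlonglongrightarrow> V_opt
    \<and> (\<exists>L. L-lipschitz_on UNIV T)
    \<and> (\<forall>L. L-lipschitz_on UNIV T \<longrightarrow>
         (\<forall>k\<ge>1. V k - V_opt \<le> ((infdist (x 1) S)\<^sup>2 + L\<^sup>2 * l\<^sup>2) / (2 * (\<Sum>i=1..k. \<alpha> i))))"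
proof -
  note interior = \<open>0 \<in> interior F\<close> and targets = assms(7)
  have T_eq: "T = (\<lambda>x. \<Sum>i=1..n. minimal_time F (\<Omega> i) x)"
    using assms(8) by (auto simp: total_time_def)
  have lipschitz: "\<exists>L. L-lipschitz_on UNIV T"
    unfolding T_eq
  proof (rule sum_lipschitz)
    show "\<exists>L. L-lipschitz_on UNIV (minimal_time F (\<Omega> i))" if "i \<in> {1..n}" for i
      using minimal_time_lipschitz[OF interior \<open>convex F\<close>] targets[OF that] by metis
  qed simp
  have minimizer: "T s \<le> T y" if "s \<in> S" for s y
    using that assms(9) by (auto simp: optimal_solutions_def)
  have V_opt: "V_opt = T s" if "s \<in> S" for s
    unfolding assms(11) using minimizer[OF that] by (intro cInf_eq_minimum) auto

  \<comment> \<open>The iteration starts at index \<open>1\<close>, the general results at index \<open>0\<close>.\<close>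
  define z where "z k = x (Suc k)" for k
  define g where "g k = (\<Sum>i=1..n. v i (Suc k))" for k
  define \<beta> where "\<beta> k = \<alpha> (Suc k)" for k
  have sum_\<beta>: "(\<Sum>i<k. \<beta> i) = (\<Sum>i=1..k. \<alpha> i)" for k
    unfolding \<beta>_def by (rule sum.reindex_bij_witness[of _ "\<lambda>i. i - 1" Suc]) auto
  have sum_squares: "(\<Sum>k. (\<beta> k)\<^sup>2) = l\<^sup>2"
    unfolding \<beta>_def using assms(17) by (rule sums_unique[symmetric])
  have subgradient: "g k \<in> subdifferential T (z k)" for k
    unfolding T_eq g_def
  proof (rule subdifferential_sum)
    fix i assume i: "i \<in> {1..n}"
    show "v i (Suc k) \<in> subdifferential (minimal_time F (\<Omega> i)) (z k)"
    proof (cases "x (Suc k) \<in> \<Omega> i")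
      case True
      then show ?thesis
        using assms(15)[of "Suc k", OF _ i] zero_subgradient_minimal_time[OF interior]
        by (simp add: z_def)
    next
      case False
      then obtain \<omega> where "\<omega> \<in> gen_projection F (\<Omega> i) (x (Suc k))"
        "v i (Suc k) \<in> uminus ` subdifferential (minkowski_gauge F) (\<omega> - x (Suc k))"
        "v i (Suc k) \<in> normal_cone \<omega> (\<Omega> i)"
        using assms(14)[of "Suc k", OF _ i] by auto
      then show ?thesis
        unfolding z_def by (intro subgradient_minimal_time[OF interior]) auto
    qed
  qed
  have descent: "subgradient_descent T z g \<beta> L" if "L-lipschitz_on UNIV T" for L
  proof
    show "summable (\<lambda>k. (\<beta> k)\<^sup>2)" unfolding \<beta>_def using assms(17) by (rule sums_summable)
  qed (use that subgradient assms(12,13) in \<open>auto simp: z_def g_def \<beta>_def\<close>)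

  have V_le: "V k \<le> T (z i)" if "i < k" for i k
    using that by (auto simp: assms(18) z_def)
  have V_ge: "V_opt \<le> V k" if k: "k \<ge> 1" for k
  proof -
    obtain s where "s \<in> S" using assms(10) by blast
    then show ?thesis using k V_opt minimizer by (auto simp: assms(18))
  qed
  have bound: "V k - V_opt \<le> ((infdist (x 1) S)\<^sup>2 + L\<^sup>2 * l\<^sup>2) / (2 * (\<Sum>i=1..k. \<alpha> i))"
    if L: "L-lipschitz_on UNIV T" and k: "k \<ge> 1" for L k
  proof -
    have "S = (\<Inter>y. {u. T u \<le> T y})"
      using assms(9) by (auto simp: optimal_solutions_def)
    moreover have "continuous_on UNIV T" using L by (rule lipschitz_on_continuous_on)
    ultimately have "closed S"
      by (auto intro!: closed_INT closed_Collect_le continuous_on_const)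
    then obtain s where s: "s \<in> S" "infdist (x 1) S = dist (x 1) s"
      using infdist_attains_inf[of S "x 1"] assms(10) by auto
    show ?thesis
      using subgradient_descent.lower_value_excess_bound[OF descent[OF L], of k "V k" s]
        k V_le s V_opt[OF s(1)]
      by (simp add: sum_\<beta> sum_squares z_def dist_norm)
  qed
  obtain s where s: "s \<in> S" using assms(10) by blast
  obtain L where L: "L-lipschitz_on UNIV T" using lipschitz by blast
  obtain u where "\<And>y. T u \<le> T y" "z \<longlonglongrightarrow> u"
    using subgradient_descent_converges[OF descent[OF L] minimizer[OF s]] assms(16)
    unfolding sum_\<beta> by blast
  then have "u \<in> S" "x \<longlonglongrightarrow> u"
    using assms(9) by (auto simp: optimal_solutions_def z_def[abs_def] filterlim_sequentially_Suc)
  moreover have "V \<longlonglongrightarrow> V_opt"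
  proof -
    have limit: "(\<lambda>k. ((infdist (x 1) S)\<^sup>2 + L\<^sup>2 * l\<^sup>2) / (2 * (\<Sum>i=1..k. \<alpha> i))) \<longlonglongrightarrow> 0"
      by (intro tendsto_divide_0[OF tendsto_const] filterlim_at_top_imp_at_infinity
          filterlim_tendsto_pos_mult_at_top[OF tendsto_const _ assms(16)]) simp
    have lower: "\<forall>\<^sub>F k in sequentially. 0 \<le> V k - V_opt"
      using V_ge by (intro eventually_sequentiallyI[of 1]) simp
    have upper: "\<forall>\<^sub>F k in sequentially.
        V k - V_opt \<le> ((infdist (x 1) S)\<^sup>2 + L\<^sup>2 * l\<^sup>2) / (2 * (\<Sum>i=1..k. \<alpha> i))"
      using bound[OF L] by (rule eventually_sequentiallyI)
    have "(\<lambda>k. V k - V_opt) \<longlonglongrightarrow> 0"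
      by (rule tendsto_sandwich[OF lower upper tendsto_const limit])
    then show ?thesis by (simp add: LIM_zero_iff)
  qed
  ultimately show ?thesis using lipschitz bound by blast
qed

end
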